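(* For a state feedback matrix $A$, the absolute minimum average packet decoding delay $D_s$ of S-IDNC is upper bounded in terms of the absolute minimum block completion time $U_s$ of S-IDNC as $$D_s\leqslant\frac{U_s+1}{2}.$$
   Context: Let $\mathbf p_1,\dots,\mathbf p_K$ be data packets and $R_1,\dots,R_N$ receivers. The state feedback matrix $A\in\{0,1\}^{N\times K}$ has $a_{n,k}=1$ if $R_n$ wants $\mathbf p_k$ and $a_{n,k}=0$ if $R_n$ already has it; $\mathcal W_n=\{\mathbf p_k:a_{n,k}=1\}$ is the Wants set of $R_n$. Let $T$ be the number of ones in $A$ (positive, so that the delay below is defined). Two distinct packets conflict if some receiver wants both (both lie in $\mathcal W_n$ for some $n$). An S-IDNC coding set is a set of pairwise non-conflicting packets (its coded packet is the binary XOR of its members). An S-IDNC solution $\mathcal S=(\mathcal M_1,\dots,\mathcal M_U)$ is a list of S-IDNC coding sets, sent in this order without erasures, such that every receiver can decode all its wanted packets (i.e. every packet wanted by some receiver lies in at least one $\mathcal M_u$). Its size is $|\mathcal S|=U$. Every receiver wanting $\mathbf p_k$ decodes it from the first coding set in $\mathcal S$ containing $\mathbf p_k$; for $(n,k)$ with $a_{n,k}=1$ let $u_{n,k}$ be the index of that coding set. The minimum average packet decoding delay of $\mathcal S$ is $D_{\mathcal S}=\frac1T\sum_{(n,k):\,a_{n,k}=1}u_{n,k}$. $U_s$ is the minimum of $|\mathcal S|$, and $D_s$ is the minimum of $D_{\mathcal S}$, each over all S-IDNC solutions $\mathcal S$ of $A$. *)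

theory Defs
  imports "HOL-Analysis.Finite_Cartesian_Product"
begin

text \<open>Receivers are the elements of the finite type \<open>'n\<close> and packets are identified with
  their indices, the elements of the finite type \<open>'k\<close>; so \<open>N = CARD('n)\<close> and \<open>K = CARD('k)\<close>.\<close>

definition state_feedback_matrix :: "nat ^ 'k::finite ^ 'n::finite \<Rightarrow> bool" where
  "state_feedback_matrix A \<longleftrightarrow> (\<forall>n k. A $ n $ k \<in> {0, 1})"

definition wants :: "nat ^ 'k::finite ^ 'n::finite \<Rightarrow> 'n \<Rightarrow> 'k set" where
  "wants A n = {k. A $ n $ k = 1}"

definition ones :: "nat ^ 'k::finite ^ 'n::finite \<Rightarrow> ('n \<times> 'k) set" where
  "ones A = {(n, k). A $ n $ k = 1}"

definition conflict :: "nat ^ 'k::finite ^ 'n::finite \<Rightarrow> 'k \<Rightarrow> 'k \<Rightarrow> bool" where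
  "conflict A k l \<longleftrightarrow> k \<noteq> l \<and> (\<exists>n. k \<in> wants A n \<and> l \<in> wants A n)"

definition coding_set :: "nat ^ 'k::finite ^ 'n::finite \<Rightarrow> 'k set \<Rightarrow> bool" where
  "coding_set A M \<longleftrightarrow> pairwise (\<lambda>k l. \<not> conflict A k l) M"

definition sidnc_solution :: "nat ^ 'k::finite ^ 'n::finite \<Rightarrow> 'k set list \<Rightarrow> bool" where
  "sidnc_solution A S \<longleftrightarrow>
     (\<forall>M \<in> set S. coding_set A M) \<and> (\<forall>n. \<forall>k \<in> wants A n. \<exists>M \<in> set S. k \<in> M)"

text \<open>The index \<open>u\<^sub>n\<^sub>,\<^sub>k\<close> is the same for all receivers \<open>n\<close> that want \<open>k\<close>, so it only takes \<open>k\<close>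
  as an argument. Coding sets are numbered from 1, whereas \<open>(!)\<close> counts from 0.\<close>

definition decoding_index :: "'k set list \<Rightarrow> 'k \<Rightarrow> nat" where
  "decoding_index S k = (LEAST u. 1 \<le> u \<and> u \<le> length S \<and> k \<in> S ! (u - 1))"

definition decoding_delay :: "nat ^ 'k::finite ^ 'n::finite \<Rightarrow> 'k set list \<Rightarrow> real" where
  "decoding_delay A S =
     1 / real (card (ones A)) * (\<Sum>(n, k) \<in> ones A. real (decoding_index S k))"

text \<open>Both minima range over an infinite set of solutions; the lemmas below show that they are
  attained, so \<open>LEAST\<close> denotes the genuine minimum also in the real-valued case.\<close>

definition min_completion_time :: "nat ^ 'k::finite ^ 'n::finite \<Rightarrow> nat" where
  "min_completion_time A = (LEAST u. \<exists>S. sidnc_solution A S \<and> u = length S)"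

definition min_decoding_delay :: "nat ^ 'k::finite ^ 'n::finite \<Rightarrow> real" where
  "min_decoding_delay A = (LEAST d. \<exists>S. sidnc_solution A S \<and> d = decoding_delay A S)"

lemma sidnc_solution_exists:
  fixes A :: "nat ^ 'k::finite ^ 'n::finite"
  shows "\<exists>S. sidnc_solution A S"
proof -
  obtain ks :: "'k list" where ks: "set ks = UNIV"
    using finite_list[OF finite[of UNIV]] by blast
  have "sidnc_solution A (map (\<lambda>k. {k}) ks)"
    by (auto simp: sidnc_solution_def coding_set_def ks)
  then show ?thesis ..
qed

lemma min_completion_time_attained:
  "\<exists>S. sidnc_solution A S \<and> length S = min_completion_time A"
proof -
  have "\<exists>S. sidnc_solution A S \<and> min_completion_time A = length S"
    unfolding min_completion_time_def
    by (rule LeastI_ex) (use sidnc_solution_exists in blast)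
  then show ?thesis by auto
qed

lemma min_completion_time_le: "sidnc_solution A S \<Longrightarrow> min_completion_time A \<le> length S"
  unfolding min_completion_time_def by (rule Least_le) blast

lemma decoding_delay_nat:
  "decoding_delay A S = real (\<Sum>(n, k) \<in> ones A. decoding_index S k) / real (card (ones A))"
  by (simp add: decoding_delay_def case_prod_unfold)

lemma min_decoding_delay_aux:
  "\<exists>S. sidnc_solution A S \<and> min_decoding_delay A = decoding_delay A S \<and>
     (\<forall>S'. sidnc_solution A S' \<longrightarrow> decoding_delay A S \<le> decoding_delay A S')"
proof -
  define t where "t S = (\<Sum>(n, k) \<in> ones A. decoding_index S k)" for S
  obtain S where S: "sidnc_solution A S" "\<And>S'. sidnc_solution A S' \<Longrightarrow> t S \<le> t S'"
    using sidnc_solution_exists[of A] ex_has_least_nat[of "sidnc_solution A" _ t] by blast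
  have le: "decoding_delay A S \<le> decoding_delay A S'" if "sidnc_solution A S'" for S'
    using S(2)[OF that] unfolding decoding_delay_nat t_def[symmetric]
    by (intro divide_right_mono) auto
  have "min_decoding_delay A = decoding_delay A S"
    unfolding min_decoding_delay_def
    by (rule Least_equality) (use S(1) le in auto)
  then show ?thesis using S(1) le by blast
qed

lemma min_decoding_delay_attained:
  "\<exists>S. sidnc_solution A S \<and> decoding_delay A S = min_decoding_delay A"
  using min_decoding_delay_aux[of A] by metis

lemma min_decoding_delay_le: "sidnc_solution A S \<Longrightarrow> min_decoding_delay A \<le> decoding_delay A S"
  using min_decoding_delay_aux[of A] by metis

end

(* Send a shortest solution either in its own order or in reverse. If k lies in the p-th of
   U coding sets, then it is decoded by time p in the one order and by time U + 1 - p in the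
   other; hence the two delays add up to at most U + 1, and one of them is at most (U + 1) / 2. *)
theory Submission
  imports Defs
begin

text \<open>Both conditions on a solution depend only on \<open>set S\<close>, not on the
  order.\<close>

lemma sidnc_solution_rev: "sidnc_solution A S \<Longrightarrow> sidnc_solution A (rev S)"
  by (simp add: sidnc_solution_def)

text \<open>Only a bound, since \<open>k\<close> may also lie in an earlier set; \<open>Suc\<close>
  shifts from positions counted from 0 to indices counted from 1.\<close>

lemma decoding_index_le: "i < length S \<Longrightarrow> k \<in> S ! i \<Longrightarrow> decoding_index S k \<le> Suc i"
  unfolding decoding_index_def by (rule Least_le) simp

lemma decoding_index_add_rev_le:
  assumes "M \<in> set S" and "k \<in> M"
  shows "decoding_index S k + decoding_index (rev S) k \<le> length S + 1"
proof -
  obtain i where i: "i < length S" "k \<in> S ! i"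
    using assms by (metis in_set_conv_nth)
  \<comment> \<open>Reversal moves the set at position \<open>i\<close> to \<open>?j\<close>, and
    \<open>Suc i + Suc ?j = length S + 1\<close>.\<close>
  let ?j = "length S - Suc i"
  have "?j < length (rev S)" "k \<in> rev S ! ?j"
    using i by (simp_all add: rev_nth Suc_diff_Suc)
  then have "decoding_index (rev S) k \<le> Suc ?j"
    by (rule decoding_index_le)
  with decoding_index_le[OF i] i(1) show ?thesis
    by simp
qed

lemma decoding_delay_add_rev_le:
  assumes "sidnc_solution A S" and "card (ones A) > 0"
  shows "decoding_delay A S + decoding_delay A (rev S) \<le> real (length S) + 1"
proof -
  \<comment> \<open>Some receiver wants \<open>k\<close>, so a coding set of the solution contains
    it.\<close>
  have "decoding_index S k + decoding_index (rev S) k \<le> length S + 1" if "(n, k) \<in> ones A" for n k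
    using assms(1) that decoding_index_add_rev_le
    by (fastforce simp: sidnc_solution_def wants_def ones_def)
  then have "(\<Sum>(n, k) \<in> ones A. decoding_index S k + decoding_index (rev S) k)
      \<le> card (ones A) * (length S + 1)"
    by (intro sum_bounded_above[where K = "length S + 1", simplified of_nat_id]) auto
  then have "real ((\<Sum>(n, k) \<in> ones A. decoding_index S k)
        + (\<Sum>(n, k) \<in> ones A. decoding_index (rev S) k))
      \<le> real (card (ones A) * (length S + 1))"
    by (simp only: of_nat_le_iff case_prod_unfold sum.distrib)
  then show ?thesis
    using assms(2)
    by (simp add: decoding_delay_nat add_divide_distrib[symmetric] divide_le_eq algebra_simps)
qed

theorem mainTheorem5:
  fixes A :: "nat ^ 'k::finite ^ 'n::finite"
  assumes "state_feedback_matrix A"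
    and "card (ones A) > 0"
  shows "min_decoding_delay A \<le> (real (min_completion_time A) + 1) / 2"
proof -
  obtain S where S: "sidnc_solution A S" "length S = min_completion_time A"
    using min_completion_time_attained by blast
  \<comment> \<open>The minimum is at most each of the two delays, so twice the minimum is at most
    their sum.\<close>
  show ?thesis
    using min_decoding_delay_le[OF S(1)] min_decoding_delay_le[OF sidnc_solution_rev[OF S(1)]]
      decoding_delay_add_rev_le[OF S(1) assms(2)] S(2)
    by simp
qed

end
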